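(* Let $n\ge 1$, and let $g,h:\mathbb{R}^n\to\mathbb{R}$ be positively homogeneous functions of degree $0\neq d\in\mathbb{R}$ and $p\in\mathbb{R}$ respectively, such that the sublevel set $\{\mathbf{x}:g(\mathbf{x})\le 1\}$ is bounded. Then for every $y\in[0,\infty)$: $$\mathrm{vol}(\{\mathbf{x}:g(\mathbf{x})\le y\})=\frac{y^{n/d}}{\Gamma(1+n/d)}\int_{\mathbb{R}^n}\exp(-g)\,d\mathbf{x},$$ and $$\int_{\{\mathbf{x}:g(\mathbf{x})\le y\}}h\,d\mathbf{x}=\frac{y^{(n+p)/d}}{\Gamma(1+(n+p)/d)}\int_{\mathbb{R}^n}h\exp(-g)\,d\mathbf{x},$$ the latter whenever $\int_{\mathbb{R}^n}|h|\exp(-g)\,d\mathbf{x}$ (or $\int_{\{\mathbf{x}:g(\mathbf{x})\le 1\}}|h|\,d\mathbf{x}$) is finite. The second identity also holds if $h$ is replaced with $|h|$, or with $\max[0,h]$, or with $\max[0,-h]$.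
   Context: A continuous function $f:\mathbb{R}^n\to\mathbb{R}$ is positively homogeneous of degree $k\in\mathbb{R}$ if $f(\lambda\mathbf{x})=\lambda^k f(\mathbf{x})$ for all $\lambda>0$ and all $\mathbf{x}\in\mathbb{R}^n$. $\mathrm{vol}$ is Lebesgue measure on $\mathbb{R}^n$; $\Gamma$ is the standard Gamma function. *)

theory Defs
  imports "HOL-Analysis.Analysis"
begin

text \<open>Continuity on the whole space, including the origin, is part of the notion.\<close>

definition positively_homogeneous :: "real \<Rightarrow> (real ^ 'n \<Rightarrow> real) \<Rightarrow> bool" where
  "positively_homogeneous k f \<longleftrightarrow>
     continuous_on UNIV f \<and> (\<forall>c>0. \<forall>x. f (c *\<^sub>R x) = c powr k * f x)"

end

theory Submission
  imports Defs
begin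

text \<open>By the change of variables \<open>x = y\<^sup>1\<^sup>/\<^sup>d u\<close>, the integral of \<open>h\<close> over
  \<open>{g \<le> y}\<close> is \<open>y\<close> raised to \<open>(n + p) / d\<close> times its value at \<open>y = 1\<close>. Writing \<open>exp (- g x)\<close> as the integral of
  \<open>exp (- t)\<close> over \<open>t \<ge> g x\<close> and exchanging the integrals, the integral of \<open>h exp (- g)\<close> becomes
  the Laplace transform of this power of \<open>y\<close> at \<open>1\<close>, which is a value of the Gamma function.
  Continuity at the origin forces \<open>d > 0\<close>, and \<open>p \<ge> 0\<close> unless \<open>h = 0\<close>; so all the integrals involved
  are finite.\<close>

section \<open>Dilations and layers of nonnegative integrals\<close>

lemma nn_integral_lborel_scaleR:
  fixes f :: "'a::euclidean_space \<Rightarrow> ennreal"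
  assumes [measurable]: "f \<in> borel_measurable borel" and "c > 0"
  shows "(\<integral>\<^sup>+x. f x \<partial>lborel) = ennreal (c ^ DIM('a)) * (\<integral>\<^sup>+x. f (c *\<^sub>R x) \<partial>lborel)"
proof -
  have "(\<integral>\<^sup>+x. f x \<partial>lborel) = (\<integral>\<^sup>+x. f x \<partial>(density (distr lborel borel (\<lambda>x. 0 + c *\<^sub>R x)) (\<lambda>_. ennreal (\<bar>c\<bar> ^ DIM('a)))))"
    using lborel_affine[of c "0::'a"] \<open>c > 0\<close> by simp
  also have "\<dots> = (\<integral>\<^sup>+x. ennreal (c ^ DIM('a)) * f (c *\<^sub>R x) \<partial>lborel)"
    using \<open>c > 0\<close> by (simp add: nn_integral_density nn_integral_distr)
  also have "\<dots> = ennreal (c ^ DIM('a)) * (\<integral>\<^sup>+x. f (c *\<^sub>R x) \<partial>lborel)"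
    by (simp add: nn_integral_cmult)
  finally show ?thesis .
qed

text \<open>The dilation by \<open>y powr (1 / d)\<close> carries \<open>{x. g x \<le> 1}\<close>
  onto \<open>{x. g x \<le> y}\<close>. Its Jacobian and the homogeneity of \<open>f\<close>
  contribute the two factors that combine into the power of \<open>y\<close>. Negative values of
  \<open>f\<close> are cut off by \<open>ennreal\<close> alike on both sides, because
  \<open>c powr q\<close> is positive.\<close>

lemma nn_integral_sublevel_homogeneous:
  fixes f g :: "'a::euclidean_space \<Rightarrow> real"
  assumes [measurable]: "f \<in> borel_measurable borel" "g \<in> borel_measurable borel"
    and f_hom: "\<And>c x. c > 0 \<Longrightarrow> f (c *\<^sub>R x) = c powr q * f x"
    and g_hom: "\<And>c x. c > 0 \<Longrightarrow> g (c *\<^sub>R x) = c powr d * g x"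
    and "d \<noteq> 0" "y > 0"
  shows "(\<integral>\<^sup>+x\<in>{x. g x \<le> y}. ennreal (f x) \<partial>lborel) =
    ennreal (y powr ((real DIM('a) + q) / d)) * (\<integral>\<^sup>+x\<in>{x. g x \<le> 1}. ennreal (f x) \<partial>lborel)"
proof -
  define c where "c = y powr (1 / d)"
  have c: "c > 0" "c powr d = y"
    using \<open>d \<noteq> 0\<close> \<open>y > 0\<close> by (auto simp: c_def powr_powr)
  have "c ^ DIM('a) * c powr q = c powr (real DIM('a) + q)"
    using c(1) by (simp add: powr_add powr_realpow)
  also have "\<dots> = y powr ((real DIM('a) + q) / d)"
    by (simp add: c_def powr_powr)
  finally have exponent: "c ^ DIM('a) * c powr q = y powr ((real DIM('a) + q) / d)" .
  have "ennreal (f (c *\<^sub>R x)) * indicator {x. g x \<le> y} (c *\<^sub>R x) =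
      ennreal (c powr q) * (ennreal (f x) * indicator {x. g x \<le> 1} x)" for x
    using c \<open>y > 0\<close> by (simp add: f_hom g_hom ennreal_mult' indicator_def)
  then have "(\<integral>\<^sup>+x\<in>{x. g x \<le> y}. ennreal (f x) \<partial>lborel) =
      ennreal (c ^ DIM('a)) * (\<integral>\<^sup>+x. ennreal (c powr q) * (ennreal (f x) * indicator {x. g x \<le> 1} x) \<partial>lborel)"
    using c(1) by (subst nn_integral_lborel_scaleR[of _ c]) auto
  also have "\<dots> = ennreal (c ^ DIM('a) * c powr q) * (\<integral>\<^sup>+x\<in>{x. g x \<le> 1}. ennreal (f x) \<partial>lborel)"
    using c(1) by (simp add: nn_integral_cmult ennreal_mult mult.assoc)
  finally show ?thesis
    by (simp add: exponent)
qed

text \<open>Tonelli on the region \<open>g x \<le> t\<close>. Since \<open>g\<close> is nonnegative,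
  \<open>t\<close> may be restricted to the half-line from 0, the domain of Euler's
  integral.\<close>

lemma nn_integral_mult_exp_layers:
  fixes f g :: "'a::euclidean_space \<Rightarrow> real"
  assumes [measurable]: "f \<in> borel_measurable borel" "g \<in> borel_measurable borel"
    and g_nonneg: "\<And>x. g x \<ge> 0"
  shows "(\<integral>\<^sup>+x. ennreal (f x * exp (- g x)) \<partial>lborel) =
    (\<integral>\<^sup>+t. ennreal (exp (- t)) * indicator {0..} t * (\<integral>\<^sup>+x\<in>{x. g x \<le> t}. ennreal (f x) \<partial>lborel) \<partial>lborel)"
proof -
  have tail: "(\<integral>\<^sup>+t. ennreal (exp (- t)) * indicator {a..} t \<partial>lborel) = ennreal (exp (- a))" for a :: real
  proof -
    have "((\<lambda>t. - exp (- t)) \<longlongrightarrow> - 0) (at_top :: real filter)"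
      by (intro tendsto_minus filterlim_compose[OF exp_at_bot] filterlim_uminus_at_bot_at_top)
    then have "(\<integral>\<^sup>+t. ennreal (exp (- t)) * indicator {a..} t \<partial>lborel) = ennreal (0 - - exp (- a))"
      by (intro nn_integral_FTC_atLeast) (auto intro!: derivative_eq_intros)
    then show ?thesis by simp
  qed
  have "(\<integral>\<^sup>+x. ennreal (f x * exp (- g x)) \<partial>lborel) =
      (\<integral>\<^sup>+x. ennreal (f x) * (\<integral>\<^sup>+t. ennreal (exp (- t)) * indicator {g x..} t \<partial>lborel) \<partial>lborel)"
    by (simp add: tail ennreal_mult'')
  \<comment> \<open>The condition \<open>g x \<le> t\<close> becomes the indicator of a subset of
    the product space, which makes the integrand jointly measurable.\<close>
  also have "\<dots> = (\<integral>\<^sup>+x. (\<integral>\<^sup>+t. ennreal (f x) * (ennreal (exp (- t)) * indicator {x. 0 \<le> x} t *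
      indicator {(x, t). g x \<le> t} (x, t)) \<partial>lborel) \<partial>lborel)"
    using g_nonneg by (subst nn_integral_cmult[symmetric])
      (auto intro!: nn_integral_cong simp: indicator_def dest: order_trans[OF g_nonneg])
  also have "\<dots> = (\<integral>\<^sup>+t. (\<integral>\<^sup>+x. ennreal (f x) * (ennreal (exp (- t)) * indicator {x. 0 \<le> x} t *
      indicator {(x, t). g x \<le> t} (x, t)) \<partial>lborel) \<partial>lborel)"
    by (rule lborel_pair.Fubini'[symmetric]) (simp add: case_prod_beta', measurable)
  also have "\<dots> = (\<integral>\<^sup>+t. ennreal (exp (- t)) * indicator {0..} t *
      (\<integral>\<^sup>+x\<in>{x. g x \<le> t}. ennreal (f x) \<partial>lborel) \<partial>lborel)"
    by (subst nn_integral_cmult[symmetric])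
      (auto intro!: nn_integral_cong simp: indicator_def ac_simps)
  finally show ?thesis .
qed

text \<open>By scaling, the layer at \<open>t\<close> contributes a power of \<open>t\<close> times
  the fixed factor \<open>?I\<close>, so the layer formula turns into Euler's integral. The
  assumption \<open>pos\<close> is the condition for that integral to converge; \<open>?I\<close>
  itself may be infinite.\<close>

lemma nn_integral_homogeneous_mult_exp:
  fixes f g :: "'a::euclidean_space \<Rightarrow> real"
  assumes [measurable]: "f \<in> borel_measurable borel" "g \<in> borel_measurable borel"
    and f_hom: "\<And>c x. c > 0 \<Longrightarrow> f (c *\<^sub>R x) = c powr q * f x"
    and g_hom: "\<And>c x. c > 0 \<Longrightarrow> g (c *\<^sub>R x) = c powr d * g x"
    and "d \<noteq> 0" and pos: "1 + (real DIM('a) + q) / d > 0"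
    and g_nonneg: "\<And>x. g x \<ge> 0"
  shows "(\<integral>\<^sup>+x. ennreal (f x * exp (- g x)) \<partial>lborel) =
    ennreal (Gamma (1 + (real DIM('a) + q) / d)) * (\<integral>\<^sup>+x\<in>{x. g x \<le> 1}. ennreal (f x) \<partial>lborel)"
    (is "_ = ennreal (Gamma (1 + ?a)) * ?I")
proof -
  have "(\<integral>\<^sup>+x. ennreal (f x * exp (- g x)) \<partial>lborel) =
      (\<integral>\<^sup>+t. ennreal (exp (- t)) * indicator {0..} t * (\<integral>\<^sup>+x\<in>{x. g x \<le> t}. ennreal (f x) \<partial>lborel) \<partial>lborel)"
    by (rule nn_integral_mult_exp_layers) (use g_nonneg in auto)
  \<comment> \<open>The exponent stays in the form \<open>1 + ?a - 1\<close> to match Euler's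
    integral at \<open>1 + ?a\<close>. Scaling needs \<open>t > 0\<close>, so the null set
    \<open>{0}\<close> is discarded.\<close>
  also have "\<dots> = (\<integral>\<^sup>+t. ennreal (indicator {0..} t * t powr (1 + ?a - 1) / exp t) * ?I \<partial>lborel)"
  proof (rule nn_integral_cong_AE, rule AE_mp[OF AE_lborel_singleton[of 0]], intro AE_I2 impI)
    fix t :: real
    assume "t \<noteq> 0"
    show "ennreal (exp (- t)) * indicator {0..} t * (\<integral>\<^sup>+x\<in>{x. g x \<le> t}. ennreal (f x) \<partial>lborel) =
        ennreal (indicator {0..} t * t powr (1 + ?a - 1) / exp t) * ?I"
    proof (cases "t > 0")
      case True
      then have "(\<integral>\<^sup>+x\<in>{x. g x \<le> t}. ennreal (f x) \<partial>lborel) = ennreal (t powr ?a) * ?I"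
        using f_hom g_hom \<open>d \<noteq> 0\<close> by (intro nn_integral_sublevel_homogeneous) auto
      then show ?thesis
        using True by (simp add: exp_minus field_simps flip: ennreal_mult mult.assoc)
    qed (use \<open>t \<noteq> 0\<close> in auto)
  qed
  also have "\<dots> = ennreal (Gamma (1 + ?a)) * ?I"
    using Gamma_conv_nn_integral_real[OF pos] by (simp add: nn_integral_multc)
  finally show ?thesis .
qed

section \<open>Continuity at the origin and the sign of the degree\<close>

lemma positively_homogeneous_tendsto_at_origin:
  assumes "positively_homogeneous k f"
  shows "((\<lambda>c. c powr k * f x) \<longlongrightarrow> f 0) (at_right 0)"
proof -
  have "isCont f 0"
    using assms by (simp add: positively_homogeneous_def continuous_on_eq_continuous_at)
  moreover have "((\<lambda>c::real. c *\<^sub>R x) \<longlongrightarrow> 0 *\<^sub>R x) (at_right 0)"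
    by (intro tendsto_intros)
  ultimately have "((\<lambda>c::real. f (c *\<^sub>R x)) \<longlongrightarrow> f 0) (at_right 0)"
    by (intro isCont_tendsto_compose[of 0 f]) simp_all
  moreover have "eventually (\<lambda>c. f (c *\<^sub>R x) = c powr k * f x) (at_right (0::real))"
    by (rule eventually_mono[OF eventually_at_right_less]) (use assms in \<open>simp add: positively_homogeneous_def\<close>)
  ultimately show ?thesis
    by (rule Lim_transform_eventually)
qed

text \<open>For \<open>k < 0\<close> the factor \<open>c powr k\<close> blows up as \<open>c\<close>
  tends to 0 from the right, while its product with \<open>f x\<close> has the finite limit
  \<open>f 0\<close>.\<close>

lemma positively_homogeneous_neg_degree:
  assumes "positively_homogeneous k f" "k < 0"
  shows "f x = 0"
proof (rule ccontr)
  assume "f x \<noteq> 0"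
  \<comment> \<open>The vanishing factor \<open>c powr (- k)\<close> cancels
    \<open>c powr k\<close>: the constant \<open>f x\<close> then has limit 0.\<close>
  have "((\<lambda>c. c powr (- k) * (c powr k * f x)) \<longlongrightarrow> 0 * f 0) (at_right 0)"
  proof (intro tendsto_mult positively_homogeneous_tendsto_at_origin assms)
    have "((\<lambda>c::real. c powr (- k)) \<longlongrightarrow> 0 powr (- k)) (at_right 0)"
      using \<open>k < 0\<close> by (intro tendsto_powr2 tendsto_ident_at tendsto_const)
        (auto intro: eventually_mono[OF eventually_at_right_less])
    then show "((\<lambda>c::real. c powr (- k)) \<longlongrightarrow> 0) (at_right 0)" by simp
  qed
  moreover have "eventually (\<lambda>c. c powr (- k) * (c powr k * f x) = f x) (at_right (0::real))"
    by (rule eventually_mono[OF eventually_at_right_less]) (simp flip: powr_add mult.assoc)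
  ultimately have "((\<lambda>c::real. f x) \<longlongrightarrow> 0 * f 0) (at_right 0)"
    by (rule Lim_transform_eventually)
  with \<open>f x \<noteq> 0\<close> show False
    by (simp add: tendsto_const_iff)
qed

lemma positively_homogeneous_at_origin:
  assumes "positively_homogeneous k f" "k \<noteq> 0"
  shows "f 0 = 0"
proof -
  have "f (2 *\<^sub>R 0) = 2 powr k * f 0"
    using assms(1) unfolding positively_homogeneous_def by (metis zero_less_numeral)
  then show ?thesis using \<open>k \<noteq> 0\<close> by simp
qed

text \<open>A point \<open>x \<noteq> 0\<close> with \<open>g x \<le> 0\<close> would put its whole
  open ray into the bounded sublevel set. Once \<open>g\<close> is positive somewhere, a negative
  degree is impossible, since it would make \<open>g\<close> vanish.\<close>

lemma positively_homogeneous_bounded_sublevel: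
  fixes g :: "real ^ 'n \<Rightarrow> real"
  assumes g: "positively_homogeneous d g" and "d \<noteq> 0" and bdd: "bounded {x. g x \<le> 1}"
  shows "d > 0" and "x \<noteq> 0 \<Longrightarrow> g x > 0"
proof -
  show pos: "g x > 0" if "x \<noteq> 0" for x
  proof (rule ccontr)
    assume "\<not> g x > 0"
    obtain B where B: "\<And>z. g z \<le> 1 \<Longrightarrow> norm z \<le> B" "B > 0"
      using bdd by (auto simp: bounded_pos)
    \<comment> \<open>Chosen so that \<open>c *\<^sub>R x\<close> has norm \<open>B + 1\<close>,
      beyond the bound.\<close>
    define c where "c = (B + 1) / norm x"
    have "c > 0" using B(2) that by (simp add: c_def)
    then have "g (c *\<^sub>R x) = c powr d * g x"
      using g by (simp add: positively_homogeneous_def)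
    also have "\<dots> \<le> 0"
      using \<open>\<not> g x > 0\<close> by (simp add: mult_nonneg_nonpos)
    finally have "norm (c *\<^sub>R x) \<le> B" by (intro B(1)) simp
    then show False using that B(2) by (simp add: c_def)
  qed
  show "d > 0"
    \<comment> \<open>Any nonzero vector would do; a coordinate unit vector exists because the index
      type is nonempty.\<close>
    using pos[of "axis undefined 1"] positively_homogeneous_neg_degree[OF g, of "axis undefined 1"] \<open>d \<noteq> 0\<close>
    by (cases d "0::real" rule: linorder_cases) (auto simp: axis_eq_0_iff)
qed

section \<open>The identity for nonnegative and for signed integrands\<close>

text \<open>Both integrals are multiples of the integral of \<open>f\<close> over
  \<open>{x. g x \<le> 1}\<close>. That one is finite, because the set is compact and
  \<open>f\<close> is continuous; eliminating it gives the identity.\<close>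

lemma integral_sublevel_homogeneous_nonneg:
  fixes f g :: "real ^ 'n \<Rightarrow> real"
  assumes g: "positively_homogeneous d g" "d \<noteq> 0" "bounded {x. g x \<le> 1}"
    and f: "positively_homogeneous q f" "\<And>x. f x \<ge> 0"
    and "y \<ge> 0"
  shows "set_integrable lborel {x. g x \<le> y} f"
    and "integrable lborel (\<lambda>x. f x * exp (- g x))"
    and "(LINT x:{x. g x \<le> y}|lborel. f x) =
      y powr ((real CARD('n) + q) / d) / Gamma (1 + (real CARD('n) + q) / d) * (LINT x|lborel. f x * exp (- g x))"
proof -
  let ?a = "(real CARD('n) + q) / d"
  have "set_integrable lborel {x. g x \<le> y} f \<and> integrable lborel (\<lambda>x. f x * exp (- g x)) \<and>
    (LINT x:{x. g x \<le> y}|lborel. f x) = y powr ?a / Gamma (1 + ?a) * (LINT x|lborel. f x * exp (- g x))"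
  \<comment> \<open>For \<open>q < 0\<close> the argument of Gamma need not be positive, but then
    \<open>f\<close> vanishes and all integrals are 0.\<close>
  proof (cases "q < 0")
    case True
    then have "f = (\<lambda>x. 0)"
      using positively_homogeneous_neg_degree[OF f(1)] by auto
    then show ?thesis by (simp add: set_integrable_def set_lebesgue_integral_def)
  next
    case False
    note d = positively_homogeneous_bounded_sublevel[OF g]
    have g_cont: "continuous_on UNIV g" and f_cont: "continuous_on UNIV f"
      and g_hom: "\<And>c x. c > 0 \<Longrightarrow> g (c *\<^sub>R x) = c powr d * g x"
      and f_hom: "\<And>c x. c > 0 \<Longrightarrow> f (c *\<^sub>R x) = c powr q * f x"
      using f g by (auto simp: positively_homogeneous_def)
    have [measurable]: "g \<in> borel_measurable borel" "f \<in> borel_measurable borel"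
      using g_cont f_cont by (auto intro: borel_measurable_continuous_onI)
    have g0: "g 0 = 0" by (rule positively_homogeneous_at_origin[OF g(1,2)])
    have g_nonneg: "g x \<ge> 0" for x
      using d(2)[of x] g0 by (cases "x = 0") auto
    have a: "?a > 0" using False d(1) by (simp add: add_pos_nonneg)
    then have Gamma: "Gamma (1 + ?a) > 0" by (intro Gamma_real_pos) simp
    have "closed {x. g x \<le> 1}"
      using g_cont by (intro closed_Collect_le) (auto intro: continuous_intros)
    with g(3) have "compact {x. g x \<le> 1}" by (simp add: compact_eq_bounded_closed)
    then have "set_integrable lborel {x. g x \<le> 1} f"
      unfolding set_integrable_def
      by (rule borel_integrable_compact) (rule continuous_on_subset[OF f_cont], simp)
    then have I: "(\<integral>\<^sup>+x\<in>{x. g x \<le> 1}. ennreal (f x) \<partial>lborel) = ennreal (LINT x:{x. g x \<le> 1}|lborel. f x)"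
      using f(2) unfolding set_integrable_def set_lebesgue_integral_def
      by (subst nn_integral_eq_integral[symmetric])
        (auto intro!: nn_integral_cong simp: indicator_def)
    define I where "I = (LINT x:{x. g x \<le> 1}|lborel. f x)"
    have "I \<ge> 0" using f(2) by (auto simp: I_def set_lebesgue_integral_def)
    have "(\<integral>\<^sup>+x. ennreal (f x * exp (- g x)) \<partial>lborel) = ennreal (Gamma (1 + ?a) * I)"
      using nn_integral_homogeneous_mult_exp[of f g q d] f_hom g_hom g_nonneg g(2) a I Gamma \<open>I \<ge> 0\<close>
      by (simp add: ennreal_mult I_def)
    then have E: "integrable lborel (\<lambda>x. f x * exp (- g x))"
        "(LINT x|lborel. f x * exp (- g x)) = Gamma (1 + ?a) * I"
      using f(2) Gamma \<open>I \<ge> 0\<close> by (auto simp: nn_integral_eq_integrable)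
    have "(\<integral>\<^sup>+x\<in>{x. g x \<le> y}. ennreal (f x) \<partial>lborel) = ennreal (y powr ?a * I)"
    \<comment> \<open>The dilation requires \<open>y > 0\<close>. At \<open>y = 0\<close> the
      sublevel set is the null set \<open>{0}\<close>, and \<open>0 powr ?a\<close> is 0 as
      well.\<close>
    proof (cases "y = 0")
      case True
      have "{x. g x \<le> y} = {0}"
        using d(2) g0 True by (auto simp: not_le[symmetric])
      with True show ?thesis
        by (simp add: nn_integral_null_set null_sets_def)
    next
      case False
      then show ?thesis
        using nn_integral_sublevel_homogeneous[of f g q d y] f_hom g_hom g(2) I \<open>y \<ge> 0\<close> \<open>I \<ge> 0\<close>
        by (simp add: ennreal_mult I_def)
    qed
    also have "(\<integral>\<^sup>+x\<in>{x. g x \<le> y}. ennreal (f x) \<partial>lborel) =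
        (\<integral>\<^sup>+x. ennreal (indicator {x. g x \<le> y} x *\<^sub>R f x) \<partial>lborel)"
      by (intro nn_integral_cong) (auto simp: indicator_def)
    finally have "set_integrable lborel {x. g x \<le> y} f" "(LINT x:{x. g x \<le> y}|lborel. f x) = y powr ?a * I"
      using f(2) \<open>I \<ge> 0\<close> unfolding set_integrable_def set_lebesgue_integral_def
      by (auto simp: nn_integral_eq_integrable)
    with E Gamma show ?thesis by simp
  qed
  then show "set_integrable lborel {x. g x \<le> y} f"
    and "integrable lborel (\<lambda>x. f x * exp (- g x))"
    and "(LINT x:{x. g x \<le> y}|lborel. f x) = y powr ?a / Gamma (1 + ?a) * (LINT x|lborel. f x * exp (- g x))"
    by auto
qed

lemma positively_homogeneous_abs:
  "positively_homogeneous k f \<Longrightarrow> positively_homogeneous k (\<lambda>x. \<bar>f x\<bar>)"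
  by (auto simp: positively_homogeneous_def abs_mult intro!: continuous_intros)

lemma positively_homogeneous_uminus:
  "positively_homogeneous k f \<Longrightarrow> positively_homogeneous k (\<lambda>x. - f x)"
  by (auto simp: positively_homogeneous_def intro!: continuous_intros)

lemma positively_homogeneous_pos_part:
  "positively_homogeneous k f \<Longrightarrow> positively_homogeneous k (\<lambda>x. max 0 (f x))"
  by (auto simp: positively_homogeneous_def max_def zero_le_mult_iff mult_le_0_iff
      intro!: continuous_intros continuous_on_max[unfolded max_def])

text \<open>Positive and negative parts of \<open>f\<close> are homogeneous of the same degree, so
  the identity holds for each with the same constant and passes to their difference.\<close>

lemma integral_sublevel_homogeneous:
  fixes f g :: "real ^ 'n \<Rightarrow> real"
  assumes g: "positively_homogeneous d g" "d \<noteq> 0" "bounded {x. g x \<le> 1}"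
    and f: "positively_homogeneous q f" and "y \<ge> 0"
  shows "set_integrable lborel {x. g x \<le> y} f"
    and "integrable lborel (\<lambda>x. f x * exp (- g x))"
    and "(LINT x:{x. g x \<le> y}|lborel. f x) =
      y powr ((real CARD('n) + q) / d) / Gamma (1 + (real CARD('n) + q) / d) * (LINT x|lborel. f x * exp (- g x))"
proof -
  let ?u = "\<lambda>x. max 0 (f x)" and ?v = "\<lambda>x. max 0 (- f x)"
  note u = integral_sublevel_homogeneous_nonneg[OF g positively_homogeneous_pos_part[OF f] _ \<open>y \<ge> 0\<close>]
  note v = integral_sublevel_homogeneous_nonneg[OF g
      positively_homogeneous_pos_part[OF positively_homogeneous_uminus[OF f]] _ \<open>y \<ge> 0\<close>]
  have f_eq: "f = (\<lambda>x. ?u x - ?v x)" by (auto simp: max_def)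
  have f_exp_eq: "(\<lambda>x. f x * exp (- g x)) = (\<lambda>x. ?u x * exp (- g x) - ?v x * exp (- g x))"
    by (auto simp: max_def)
  show "set_integrable lborel {x. g x \<le> y} f"
    by (subst f_eq, intro set_integral_diff u v) auto
  show "integrable lborel (\<lambda>x. f x * exp (- g x))"
    by (subst f_exp_eq, intro Bochner_Integration.integrable_diff u v) auto
  have "(LINT x:{x. g x \<le> y}|lborel. f x) = (LINT x:{x. g x \<le> y}|lborel. ?u x) - (LINT x:{x. g x \<le> y}|lborel. ?v x)"
    by (subst f_eq, intro set_integral_diff u v) auto
  moreover have "(LINT x|lborel. f x * exp (- g x)) =
      (LINT x|lborel. ?u x * exp (- g x)) - (LINT x|lborel. ?v x * exp (- g x))"
    by (subst f_exp_eq, intro Bochner_Integration.integral_diff u v) auto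
  ultimately show "(LINT x:{x. g x \<le> y}|lborel. f x) =
      y powr ((real CARD('n) + q) / d) / Gamma (1 + (real CARD('n) + q) / d) * (LINT x|lborel. f x * exp (- g x))"
    using u(3) v(3) by (simp add: right_diff_distrib)
qed

section \<open>Volume and weighted integrals of sublevel sets\<close>

theorem theorem2p2:
  fixes g h :: "real ^ 'n \<Rightarrow> real" and d p y :: real
  assumes "d \<noteq> 0"
    and "positively_homogeneous d g"
    and "positively_homogeneous p h"
    and "bounded {x. g x \<le> 1}"
    and "0 \<le> y"
  shows "integrable lborel (\<lambda>x. exp (- g x)) \<and>
         emeasure lborel {x. g x \<le> y} =
           ennreal (y powr (real CARD('n) / d) / Gamma (1 + real CARD('n) / d) *
                    (LINT x|lborel. exp (- g x))) \<and>
         (\<forall>f \<in> {h, \<lambda>x. \<bar>h x\<bar>, \<lambda>x. max 0 (h x), \<lambda>x. max 0 (- h x)}.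
           (\<integral>\<^sup>+x. ennreal (\<bar>f x\<bar> * exp (- g x)) \<partial>lborel) < \<infinity> \<or>
           (\<integral>\<^sup>+x\<in>{x. g x \<le> 1}. ennreal \<bar>f x\<bar> \<partial>lborel) < \<infinity> \<longrightarrow>
             set_integrable lborel {x. g x \<le> y} f \<and>
             integrable lborel (\<lambda>x. f x * exp (- g x)) \<and>
             (LINT x:{x. g x \<le> y}|lborel. f x) =
               y powr ((real CARD('n) + p) / d) / Gamma (1 + (real CARD('n) + p) / d) *
               (LINT x|lborel. f x * exp (- g x)))"
proof (intro conjI ballI impI)
  \<comment> \<open>The volume is the integral of the constant 1, which has degree 0.\<close>
  have one: "positively_homogeneous 0 (\<lambda>x::real^'n. 1)"
    by (simp add: positively_homogeneous_def)
  note vol = integral_sublevel_homogeneous[OF assms(2,1,4) one \<open>0 \<le> y\<close>]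
  show "integrable lborel (\<lambda>x. exp (- g x))"
    using vol(2) by simp
  have "closed {x. g x \<le> y}"
    using assms(2) by (intro closed_Collect_le) (auto simp: positively_homogeneous_def)
  then have "{x. g x \<le> y} \<in> sets lborel"
    by (simp add: borel_closed)
  \<comment> \<open>Integrability of the indicator makes the measure finite, so the real integral
    determines \<open>emeasure\<close>.\<close>
  moreover have "integrable lborel (indicator {x. g x \<le> y} :: _ \<Rightarrow> real)"
    using vol(1) by (simp add: set_integrable_def)
  ultimately have "emeasure lborel {x. g x \<le> y} = ennreal (LINT x:{x. g x \<le> y}|lborel. 1)"
    by (simp add: set_lebesgue_integral_def emeasure_eq_ennreal_measure integrable_indicator_iff less_top)
  then show "emeasure lborel {x. g x \<le> y} =
      ennreal (y powr (real CARD('n) / d) / Gamma (1 + real CARD('n) / d) * (LINT x|lborel. exp (- g x)))"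
    using vol(3) by simp
next
  fix f
  assume "f \<in> {h, \<lambda>x. \<bar>h x\<bar>, \<lambda>x. max 0 (h x), \<lambda>x. max 0 (- h x)}"
  \<comment> \<open>All four choices of \<open>f\<close> share the degree \<open>p\<close>, so one
    identity serves them all.\<close>
  then have "positively_homogeneous p f"
    using assms(3) by (auto intro: positively_homogeneous_abs positively_homogeneous_pos_part
        positively_homogeneous_uminus)
  note f = integral_sublevel_homogeneous[OF assms(2,1,4) this \<open>0 \<le> y\<close>]
  show "set_integrable lborel {x. g x \<le> y} f"
    and "integrable lborel (\<lambda>x. f x * exp (- g x))"
    and "(LINT x:{x. g x \<le> y}|lborel. f x) =
      y powr ((real CARD('n) + p) / d) / Gamma (1 + (real CARD('n) + p) / d) *
      (LINT x|lborel. f x * exp (- g x))"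
    using f by auto
qed

end
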